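(* Let $\mathbf{X}_1=(X_{11},\ldots,X_{1n})$ and $\mathbf{X}_2=(X_{21},\ldots,X_{2n})$ be non-negative, arbitrarily dependent random vectors with distributions $\mathbf{F}_1,\mathbf{F}_2\in\mathcal{D}_n$ respectively. Assume that any $n$-dimensional random vector consisting of some components of $\mathbf{X}_1$ and some components of $\mathbf{X}_2$ has a distribution belonging to $\mathcal{D}_n$. Then $\mathbf{F}_{\mathbf{X}_1+\mathbf{X}_2}\in\mathcal{D}_n$, where $\mathbf{F}_{\mathbf{X}_1+\mathbf{X}_2}$ is the distribution of $\mathbf{X}_1+\mathbf{X}_2$.
   Context: For a univariate distribution $F$ write $\overline{F}:=1-F$; throughout $\overline{F}(x)>0$ for all $x\ge0$. $f\asymp g$ means $f=O(g)$ and $g=O(f)$ as $x\to\infty$. $F\in\mathcal{D}$ (dominatedly varying) if for all (equivalently, for some) $b\in(0,1)$, $\limsup_{x\to\infty}\overline{F}(bx)/\overline{F}(x)<\infty$. For a random vector $\mathbf{X}$ with distribution $\mathbf{F}$, the tail is $\overline{\mathbf{F}}(\mathbf{t},x)=\mathbf{P}[X_1>t_1x,\ldots,X_n>t_nx]$ for $\mathbf{t}\in(0,\infty]^n\setminus\{(\infty,\ldots,\infty)\}$; if $t_i=\infty$ the dimension is reduced, i.e. the $i$-th component is dropped. $\mathbf{b}\,\mathbf{t}=(b_1t_1,\ldots,b_nt_n)$. The tail of the sum is $\overline{\mathbf{F}_{\mathbf{X}_1+\mathbf{X}_2}}(\mathbf{t},x)=\mathbf{P}[X_{11}+X_{21}>t_1x,\ldots,X_{1n}+X_{2n}>t_nx]$.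 $\mathbf{F}\in\mathcal{D}_n$ (multivariate dominatedly varying) if there is a univariate $F\in\mathcal{D}$ (called a weak kernel) with $\overline{F}_i(x)\asymp\overline{F}(x)$ as $x\to\infty$ for every marginal $F_i$, $i=1,\ldots,n$, and $\limsup_{x\to\infty}\overline{\mathbf{F}}(\mathbf{b}\,\mathbf{t},x)/\overline{\mathbf{F}}(\mathbf{t},x)<\infty$ for all $\mathbf{t}\in(0,\infty]^n\setminus\{(\infty,\ldots,\infty)\}$ and all (equivalently, for some) $\mathbf{b}\in(0,1)^n$. (Writing this quotient presupposes that the joint tail is positive.) A "vector consisting of some components of $\mathbf{X}_1$ and some components of $\mathbf{X}_2$" is a vector formed from $n$ distinct members of the family $\{X_{ij}: i=1,2,\ j=1,\ldots,n\}$. *)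

theory Defs
  imports "HOL-Probability.Probability" "HOL-Library.Landau_Symbols"
begin

text \<open>Distributions are represented by probability measures on the Borel sets.\<close>

definition tail :: "real measure \<Rightarrow> real \<Rightarrow> real" where
  "tail F x = 1 - cdf F x"

definition dominatedly_varying :: "real measure \<Rightarrow> bool" where
  "dominatedly_varying F \<longleftrightarrow>
     real_distribution F \<and> (\<forall>x\<ge>0. tail F x > 0) \<and>
     (\<forall>b. 0 < b \<and> b < 1 \<longrightarrow>
        Limsup at_top (\<lambda>x. ereal (tail F (b * x) / tail F x)) < \<infinity>)"

text \<open>A coordinate with \<open>t $ i = \<infinity>\<close> imposes no constraint: it is dropped from the joint
  tail, which thus becomes that of a lower-dimensional marginal.\<close>

definition joint_tail :: "(real^'n) measure \<Rightarrow> ereal^'n \<Rightarrow> real \<Rightarrow> real" where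
  "joint_tail F t x = measure F {v. \<forall>i. t $ i \<noteq> \<infinity> \<longrightarrow> ereal (v $ i) > t $ i * ereal x}"

definition tail_directions :: "(ereal^'n) set" where
  "tail_directions = {t. (\<forall>i. 0 < t $ i) \<and> (\<exists>i. t $ i \<noteq> \<infinity>)}"

definition scale_direction :: "real^'n \<Rightarrow> ereal^'n \<Rightarrow> ereal^'n" where
  "scale_direction b t = (\<chi> i. ereal (b $ i) * t $ i)"

definition marginal :: "(real^'n) measure \<Rightarrow> 'n \<Rightarrow> real measure" where
  "marginal F i = distr F borel (\<lambda>v. v $ i)"

text \<open>The joint tails are required to be positive explicitly: the defining quotient presupposes
  this, and division by zero is zero in HOL.\<close>

definition mv_dominatedly_varying :: "(real^'n) measure \<Rightarrow> bool" where
  "mv_dominatedly_varying F \<longleftrightarrow>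
     prob_space F \<and> sets F = sets borel \<and>
     (\<exists>G. dominatedly_varying G \<and> (\<forall>i. tail (marginal F i) \<in> \<Theta>[at_top](tail G))) \<and>
     (\<forall>t\<in>tail_directions. \<forall>x\<ge>0. joint_tail F t x > 0) \<and>
     (\<forall>t\<in>tail_directions. \<forall>b. (\<forall>i. 0 < b $ i \<and> b $ i < 1) \<longrightarrow>
        Limsup at_top (\<lambda>x. ereal (joint_tail F (scale_direction b t) x / joint_tail F t x)) < \<infinity>)"

text \<open>The family of all \<open>2n\<close> components is indexed by \<open>'n + 'n\<close>; a selection \<open>\<sigma>\<close> picks the
  component that becomes the \<open>k\<close>-th entry, and \<open>inj \<sigma>\<close> says that the members picked are distinct
  (as members of the family; they may be equal as random variables).\<close>

definition component :: "('a \<Rightarrow> real^'n) \<Rightarrow> ('a \<Rightarrow> real^'n) \<Rightarrow> 'n + 'n \<Rightarrow> 'a \<Rightarrow> real" where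
  "component X1 X2 s \<omega> = (case s of Inl j \<Rightarrow> X1 \<omega> $ j | Inr j \<Rightarrow> X2 \<omega> $ j)"

definition selected_vector ::
    "('a \<Rightarrow> real^'n) \<Rightarrow> ('a \<Rightarrow> real^'n) \<Rightarrow> ('n \<Rightarrow> 'n + 'n) \<Rightarrow> 'a \<Rightarrow> real^'n" where
  "selected_vector X1 X2 \<sigma> \<omega> = (\<chi> k. component X1 X2 (\<sigma> k) \<omega>)"

end

theory Submission
  imports Defs
begin

text \<open>
  The argument is the single big jump at the level of coordinates. If \<open>X1 $ i + X2 $ i > s\<close>, then one
  of the two summands exceeds \<open>s / 2\<close>. Applied to every coordinate, this bounds the joint tail of the
  sum in direction \<open>b t\<close> by the sum, over the finitely many ways of choosing a summand for each
  coordinate, of the joint tails of the chosen vectors in direction \<open>(b / 2) t\<close>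
  (\<open>joint_tail_sum_le\<close>). A chosen vector has distinct members of the family as its entries,
  so by hypothesis it is dominatedly varying, and the factor \<open>b / 2\<close>, which again lies in \<open>(0,1)\<close>, can be
  removed at the cost of a constant. Finally, by non-negativity, a sum is at least as large as
  either summand, so the tails of the chosen vectors in direction \<open>t\<close> are at most that of the sum
  (\<open>joint_tail_choice_le\<close>).

  It remains to find a weak kernel. In dimension one the kernels of \<open>X1\<close> and \<open>X2\<close> may be of
  different orders, each exceeding the other along some sequence, and then neither serves for the
  sum. A kernel that works in every dimension is found among the marginals of the sum itself.
  The estimate for joint tails, used in a direction with only one finite entry, shows
  that every marginal of the sum is dominatedly varying (\<open>dominatedly_varying_marginal\<close>).
  Any two of these marginals are comparable: halving passes from a coordinate of the sum to the
  summands, comparability within each summand changes the coordinate, and dominated variation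
  undoes the halving. Hence any marginal of the sum is a weak kernel.
\<close>

section \<open>Tails and their growth\<close>

text \<open>Turns the conditions on upper limits of quotients into Landau form, in which sums and
  changes of variable are handled by the calculus of \<open>O\<close>.\<close>

lemma Limsup_quotient_finite_iff_bigo:
  fixes f g :: "real \<Rightarrow> real"
  assumes f: "\<And>x. 0 \<le> f x" and g: "\<And>x. 0 \<le> x \<Longrightarrow> 0 < g x"
  shows "Limsup at_top (\<lambda>x. ereal (f x / g x)) < \<infinity> \<longleftrightarrow> f \<in> O[at_top](g)"
proof
  assume L: "Limsup at_top (\<lambda>x. ereal (f x / g x)) < \<infinity>"
  then obtain r where "Limsup at_top (\<lambda>x. ereal (f x / g x)) < ereal r"
    using less_PInf_Ex_of_nat[of "Limsup at_top (\<lambda>x. ereal (f x / g x))"] by auto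
  then have "\<forall>\<^sub>F x in at_top. ereal (f x / g x) < ereal r"
    by (rule Limsup_lessD)
  then have "\<forall>\<^sub>F x in at_top. norm (f x) \<le> r * norm (g x)"
    using eventually_ge_at_top[of 0]
    by eventually_elim (use f g in \<open>fastforce simp: field_simps abs_of_pos\<close>)
  then show "f \<in> O[at_top](g)"
    by (rule bigoI)
next
  assume "f \<in> O[at_top](g)"
  then obtain c where "\<forall>\<^sub>F x in at_top. norm (f x) \<le> c * norm (g x)"
    by (elim landau_o.bigE)
  then have "\<forall>\<^sub>F x in at_top. ereal (f x / g x) \<le> ereal c"
    using eventually_ge_at_top[of 0]
    by eventually_elim (use f g in \<open>fastforce simp: field_simps abs_of_pos\<close>)
  then have "Limsup at_top (\<lambda>x. ereal (f x / g x)) \<le> ereal c"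
    by (rule Limsup_bounded)
  then show "Limsup at_top (\<lambda>x. ereal (f x / g x)) < \<infinity>"
    by (rule le_less_trans) simp
qed

lemma joint_tail_nonneg: "0 \<le> joint_tail F t x"
  by (simp add: joint_tail_def)

lemma mv_dominatedly_varying_bigo:
  assumes "mv_dominatedly_varying F" and "t \<in> tail_directions"
    and "\<forall>i. 0 < b $ i \<and> b $ i < 1"
  shows "joint_tail F (scale_direction b t) \<in> O[at_top](joint_tail F t)"
  using assms
  by (subst Limsup_quotient_finite_iff_bigo[symmetric])
     (auto simp: joint_tail_nonneg mv_dominatedly_varying_def)

lemma joint_tail_distr:
  fixes X :: "'a \<Rightarrow> real^'n"
  assumes [measurable]: "X \<in> borel_measurable M"
  shows "joint_tail (distr M borel X) t x =
    measure M {\<omega> \<in> space M. \<forall>i. t $ i \<noteq> \<infinity> \<longrightarrow> ereal (X \<omega> $ i) > t $ i * ereal x}"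
proof -
  have "{v :: real^'n. \<forall>i. t $ i \<noteq> \<infinity> \<longrightarrow> ereal (v $ i) > t $ i * ereal x} \<in> sets borel"
    by measurable
  then show ?thesis
    unfolding joint_tail_def by (subst measure_distr) (auto intro!: arg_cong[where f="measure M"])
qed

lemma tail_eq_measure:
  assumes "real_distribution F"
  shows "tail F x = measure F {x<..}"
proof -
  interpret real_distribution F by fact
  have "{x<..} = space F - {..x}"
    by auto
  then show ?thesis
    using prob_compl[of "{..x}"] by (simp add: tail_def cdf_def)
qed

lemma real_distribution_marginal:
  assumes "prob_space F" and "sets F = sets (borel :: (real^'n) measure)"
  shows "real_distribution (marginal F i)"
proof -
  interpret prob_space F by fact
  have "(\<lambda>v. v $ i) \<in> borel_measurable F"
    using measurable_cong_sets[OF assms(2) refl] borel_measurable_nth by blast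
  then show ?thesis
    unfolding marginal_def by (rule real_distribution_distr)
qed

lemma tail_marginal:
  assumes "prob_space F" and "sets F = sets (borel :: (real^'n) measure)"
  shows "tail (marginal F i) x = measure F {v. v $ i > x}"
proof -
  have [measurable]: "(\<lambda>v. v $ i) \<in> borel_measurable F"
    using measurable_cong_sets[OF assms(2) refl] borel_measurable_nth by blast
  have sp: "space F = UNIV"
    using sets_eq_imp_space_eq[OF assms(2)] by simp
  have "tail (marginal F i) x = measure (marginal F i) {x<..}"
    using real_distribution_marginal[OF assms] by (rule tail_eq_measure)
  then show ?thesis
    by (simp add: marginal_def measure_distr sp vimage_def)
qed

lemma tail_marginal_distr:
  fixes X :: "'a \<Rightarrow> real^'n"
  assumes "prob_space M" and [measurable]: "X \<in> borel_measurable M"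
  shows "tail (marginal (distr M borel X) i) x = measure M {\<omega> \<in> space M. X \<omega> $ i > x}"
proof -
  interpret prob_space M by fact
  have "prob_space (distr M borel X)"
    by (rule prob_space_distr) fact
  moreover have "{v :: real^'n. v $ i > x} \<in> sets borel"
    by measurable
  ultimately show ?thesis
    by (simp add: tail_marginal measure_distr vimage_def Int_def conj_commute)
qed

section \<open>Marginals as one-dimensional joint tails\<close>

text \<open>Dropping all coordinates but one turns the joint tail into a marginal tail, so that the
  conditions on joint tails already make every marginal dominatedly varying. For a sum this is where the candidate
  for a weak kernel comes from, so only conditions on joint tails may enter.\<close>

lemma dominatedly_varying_marginal:
  fixes F :: "(real^'n) measure"
  assumes F: "prob_space F" "sets F = sets borel"
    and pos: "\<And>t x. t \<in> tail_directions \<Longrightarrow> 0 \<le> x \<Longrightarrow> 0 < joint_tail F t x"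
    and bigo: "\<And>t b. t \<in> tail_directions \<Longrightarrow> \<forall>i. 0 < b $ i \<and> b $ i < 1 \<Longrightarrow>
      joint_tail F (scale_direction b t) \<in> O[at_top](joint_tail F t)"
  shows "dominatedly_varying (marginal F i)"
proof -
  define t :: "ereal^'n" where "t = (\<chi> j. if j = i then 1 else \<infinity>)"
  have t: "t \<in> tail_directions"
    by (auto simp: tail_directions_def t_def)
  have tail_t: "joint_tail F t = tail (marginal F i)"
    by (rule ext) (simp add: joint_tail_def t_def tail_marginal[OF F])
  have tail_bt: "joint_tail F (scale_direction (\<chi> j. b) t) = (\<lambda>x. tail (marginal F i) (b * x))"
    if "0 < b" for b
    using that
    by (intro ext) (auto simp: joint_tail_def t_def scale_direction_def tail_marginal[OF F]
        intro!: arg_cong[where f="measure F"] split: if_splits)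
  have tpos: "0 < tail (marginal F i) x" if "0 \<le> x" for x
    using pos[OF t that] by (simp add: tail_t)
  have "Limsup at_top (\<lambda>x. ereal (tail (marginal F i) (b * x) / tail (marginal F i) x)) < \<infinity>"
    if b: "0 < b" "b < 1" for b
  proof (subst Limsup_quotient_finite_iff_bigo)
    show "(\<lambda>x. tail (marginal F i) (b * x)) \<in> O(tail (marginal F i))"
      using bigo[OF t, of "\<chi> j. b"] b by (simp add: tail_t tail_bt)
  qed (simp add: tail_marginal[OF F], rule tpos)
  then show ?thesis
    using tpos real_distribution_marginal[OF F] by (simp add: dominatedly_varying_def)
qed

lemma marginal_tails_comparable:
  assumes "mv_dominatedly_varying F"
  shows "tail (marginal F i) \<in> O[at_top](tail (marginal F j))"
proof -
  obtain G where "\<And>i. tail (marginal F i) \<in> \<Theta>[at_top](tail G)"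
    using assms by (auto simp: mv_dominatedly_varying_def)
  then have "tail (marginal F i) \<in> \<Theta>[at_top](tail (marginal F j))"
    by (meson bigtheta_sym landau_theta.trans)
  then show ?thesis
    by (rule bigthetaD1)
qed

section \<open>Choosing a summand for each coordinate\<close>

definition choice :: "('n \<Rightarrow> bool) \<Rightarrow> 'n \<Rightarrow> 'n + 'n" where
  "choice c i = (if c i then Inl i else Inr i)"

lemma inj_choice: "inj (choice c)"
  by (auto simp: inj_def choice_def split: if_splits)

lemma selected_vector_choice:
  "selected_vector X1 X2 (choice c) \<omega> $ i = (if c i then X1 \<omega> $ i else X2 \<omega> $ i)"
  by (simp add: selected_vector_def component_def choice_def)

lemma borel_measurable_selected_vector_choice [measurable]:
  fixes X1 X2 :: "'a \<Rightarrow> real^'n"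
  assumes [measurable]: "X1 \<in> borel_measurable M" "X2 \<in> borel_measurable M"
  shows "selected_vector X1 X2 (choice c) \<in> borel_measurable M"
proof -
  have "(\<lambda>\<omega>. selected_vector X1 X2 (choice c) \<omega> $ i) \<in> borel_measurable M" for i
    using assms[THEN measurable_compose[OF _ borel_measurable_nth]]
    by (cases "c i") (simp_all add: selected_vector_choice)
  then show ?thesis
    by (subst borel_measurable_euclidean_space) (auto simp: Basis_vec_def inner_axis)
qed

context
  fixes M :: "'a measure" and X1 X2 :: "'a \<Rightarrow> real^'n"
  assumes M: "prob_space M"
    and X [measurable]: "X1 \<in> borel_measurable M" "X2 \<in> borel_measurable M"
begin

interpretation prob_space M by (rule M)

text \<open>On the event on the left, choose in each coordinate a summand that carries at least half of
  the sum; the right-hand side is the union bound over all choices.\<close>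

lemma joint_tail_sum_le:
  assumes t: "t \<in> tail_directions" and b: "\<forall>i. 0 < b $ i"
  shows "joint_tail (distr M borel (\<lambda>\<omega>. X1 \<omega> + X2 \<omega>)) (scale_direction b t) x \<le>
    (\<Sum>c\<in>UNIV. joint_tail (distr M borel (selected_vector X1 X2 (choice c)))
                  (scale_direction (b /\<^sub>R 2) t) x)"
proof -
  define S where "S = {\<omega> \<in> space M. \<forall>i. scale_direction b t $ i \<noteq> \<infinity> \<longrightarrow>
    ereal ((X1 \<omega> + X2 \<omega>) $ i) > scale_direction b t $ i * ereal x}"
  define E where "E c = {\<omega> \<in> space M. \<forall>i. scale_direction (b /\<^sub>R 2) t $ i \<noteq> \<infinity> \<longrightarrow>
    ereal (selected_vector X1 X2 (choice c) \<omega> $ i) > scale_direction (b /\<^sub>R 2) t $ i * ereal x}" for c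
  have [measurable]: "E c \<in> sets M" for c
    unfolding E_def by measurable
  have "S \<subseteq> (\<Union>c. E c)"
  proof
    fix \<omega> assume \<omega>: "\<omega> \<in> S"
    define c where "c i \<longleftrightarrow> X2 \<omega> $ i \<le> X1 \<omega> $ i" for i
    have "ereal (selected_vector X1 X2 (choice c) \<omega> $ i) > scale_direction (b /\<^sub>R 2) t $ i * ereal x"
      if fin: "scale_direction (b /\<^sub>R 2) t $ i \<noteq> \<infinity>" for i
    proof -
      have bi: "0 < b $ i"
        using b by simp
      obtain r where r: "t $ i = ereal r"
        using fin t bi spec[of "\<lambda>i. 0 < t $ i" i]
        by (cases "t $ i") (auto simp: scale_direction_def tail_directions_def)
      then have "b $ i * r * x < X1 \<omega> $ i + X2 \<omega> $ i"
        using \<omega> bi by (auto simp: S_def scale_direction_def dest!: spec[of _ i])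
      then show ?thesis
        by (simp add: r scale_direction_def selected_vector_choice c_def field_simps)
    qed
    then show "\<omega> \<in> (\<Union>c. E c)"
      using \<omega> by (auto simp: S_def E_def)
  qed
  then have "prob S \<le> prob (\<Union>c. E c)"
    by (intro finite_measure_mono) auto
  also have "\<dots> \<le> (\<Sum>c\<in>UNIV. prob (E c))"
    by (intro finite_measure_subadditive_finite) auto
  finally show ?thesis
    by (simp add: joint_tail_distr S_def E_def)
qed

lemma tail_marginal_sum_le:
  "tail (marginal (distr M borel (\<lambda>\<omega>. X1 \<omega> + X2 \<omega>)) i) x \<le>
    tail (marginal (distr M borel X1) i) (x / 2) + tail (marginal (distr M borel X2) i) (x / 2)"
proof -
  have "prob {\<omega> \<in> space M. (X1 \<omega> + X2 \<omega>) $ i > x} \<le>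
      prob ({\<omega> \<in> space M. X1 \<omega> $ i > x / 2} \<union> {\<omega> \<in> space M. X2 \<omega> $ i > x / 2})"
    by (intro finite_measure_mono) auto
  also have "\<dots> \<le> prob {\<omega> \<in> space M. X1 \<omega> $ i > x / 2} + prob {\<omega> \<in> space M. X2 \<omega> $ i > x / 2}"
    by (intro measure_Un_le) auto
  finally show ?thesis
    by (simp add: tail_marginal_distr[OF M])
qed

context
  assumes nonneg: "AE \<omega> in M. \<forall>i. 0 \<le> X1 \<omega> $ i" "AE \<omega> in M. \<forall>i. 0 \<le> X2 \<omega> $ i"
begin

text \<open>The other summand is non-negative, so each entry of the chosen vector is at most the
  corresponding entry of the sum.\<close>

lemma joint_tail_choice_le:
  "joint_tail (distr M borel (selected_vector X1 X2 (choice c))) t x \<le>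
    joint_tail (distr M borel (\<lambda>\<omega>. X1 \<omega> + X2 \<omega>)) t x"
proof -
  have "AE \<omega> in M. \<forall>i. selected_vector X1 X2 (choice c) \<omega> $ i \<le> (X1 \<omega> + X2 \<omega>) $ i"
    using nonneg by eventually_elim (simp add: selected_vector_choice)
  then have le: "AE \<omega> in M. \<forall>i. ereal (selected_vector X1 X2 (choice c) \<omega> $ i) \<le>
      ereal ((X1 \<omega> + X2 \<omega>) $ i)"
    by simp
  have "prob {\<omega> \<in> space M. \<forall>i. t $ i \<noteq> \<infinity> \<longrightarrow>
        ereal (selected_vector X1 X2 (choice c) \<omega> $ i) > t $ i * ereal x} \<le>
      prob {\<omega> \<in> space M. \<forall>i. t $ i \<noteq> \<infinity> \<longrightarrow> ereal ((X1 \<omega> + X2 \<omega>) $ i) > t $ i * ereal x}"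
    (is "prob ?E \<le> prob ?S")
  proof (rule finite_measure_mono_AE)
    show "AE \<omega> in M. \<omega> \<in> ?E \<longrightarrow> \<omega> \<in> ?S"
      using le by eventually_elim (blast intro: less_le_trans)
  qed measurable
  then show ?thesis
    by (simp add: joint_tail_distr)
qed

lemma tail_marginal_summand_le:
  "tail (marginal (distr M borel X1) i) x \<le> tail (marginal (distr M borel (\<lambda>\<omega>. X1 \<omega> + X2 \<omega>)) i) x"
  "tail (marginal (distr M borel X2) i) x \<le> tail (marginal (distr M borel (\<lambda>\<omega>. X1 \<omega> + X2 \<omega>)) i) x"
proof -
  have *: "tail (marginal (distr M borel Y) i) x \<le> tail (marginal (distr M borel (\<lambda>\<omega>. X1 \<omega> + X2 \<omega>)) i) x"
    if Y: "Y \<in> borel_measurable M" and le: "AE \<omega> in M. Y \<omega> $ i \<le> (X1 \<omega> + X2 \<omega>) $ i" for Y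
  proof -
    have "prob {\<omega> \<in> space M. Y \<omega> $ i > x} \<le> prob {\<omega> \<in> space M. (X1 \<omega> + X2 \<omega>) $ i > x}"
    proof (rule finite_measure_mono_AE)
      show "AE \<omega> in M. \<omega> \<in> {\<omega> \<in> space M. Y \<omega> $ i > x} \<longrightarrow>
          \<omega> \<in> {\<omega> \<in> space M. (X1 \<omega> + X2 \<omega>) $ i > x}"
        using le by eventually_elim auto
    qed measurable
    then show ?thesis
      using Y by (simp add: tail_marginal_distr[OF M])
  qed
  show "tail (marginal (distr M borel X1) i) x \<le> tail (marginal (distr M borel (\<lambda>\<omega>. X1 \<omega> + X2 \<omega>)) i) x"
    using X(1) by (rule *) (use nonneg(2) in \<open>eventually_elim, simp\<close>)
  show "tail (marginal (distr M borel X2) i) x \<le> tail (marginal (distr M borel (\<lambda>\<omega>. X1 \<omega> + X2 \<omega>)) i) x"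
    using X(2) by (rule *) (use nonneg(1) in \<open>eventually_elim, simp\<close>)
qed

end

end

section \<open>Closure under sums\<close>

theorem theorem5p2:
  fixes M :: "'a measure" and X1 X2 :: "'a \<Rightarrow> real^'n"
  assumes "prob_space M"
    and "X1 \<in> borel_measurable M" and "X2 \<in> borel_measurable M"
    and "AE \<omega> in M. \<forall>i. X1 \<omega> $ i \<ge> 0" and "AE \<omega> in M. \<forall>i. X2 \<omega> $ i \<ge> 0"
    and "mv_dominatedly_varying (distr M borel X1)"
    and "mv_dominatedly_varying (distr M borel X2)"
    and "\<And>\<sigma> :: 'n \<Rightarrow> 'n + 'n. inj \<sigma> \<Longrightarrow>
           mv_dominatedly_varying (distr M borel (selected_vector X1 X2 \<sigma>))"
  shows "mv_dominatedly_varying (distr M borel (\<lambda>\<omega>. X1 \<omega> + X2 \<omega>))"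
proof -
  let ?S = "distr M borel (\<lambda>\<omega>. X1 \<omega> + X2 \<omega>)"
  let ?F = "\<lambda>c. distr M borel (selected_vector X1 X2 (choice c))"
  interpret prob_space M by fact
  note [measurable] = assms(2,3)
  have F: "mv_dominatedly_varying (?F c)" for c
    using assms(8) inj_choice .
  have S: "prob_space ?S" "sets ?S = sets borel"
    by (auto intro: prob_space_distr)
  have F_le_S: "joint_tail (?F c) t x \<le> joint_tail ?S t x" for c t x
    by (rule joint_tail_choice_le[OF assms(1-5)])

  \<comment> \<open>Each choice bounds the sum from below; the constant one selects \<open>X1\<close> itself.\<close>
  have pos: "0 < joint_tail ?S t x" if "t \<in> tail_directions" "0 \<le> x" for t x
    using F[of "\<lambda>_. True"] F_le_S[of "\<lambda>_. True" t x] that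
    by (fastforce simp: mv_dominatedly_varying_def)

  have bigo: "joint_tail ?S (scale_direction b t) \<in> O[at_top](joint_tail ?S t)"
    if t: "t \<in> tail_directions" and b: "\<forall>i. 0 < b $ i \<and> b $ i < 1" for t b
  proof -
    have "joint_tail (?F c) (scale_direction (b /\<^sub>R 2) t) \<in> O[at_top](joint_tail ?S t)" for c
    proof (rule landau_o.big_trans)
      have "\<forall>i. 0 < (b /\<^sub>R 2) $ i \<and> (b /\<^sub>R 2) $ i < 1"
        using b by (auto simp: field_simps intro: less_trans[of _ 1])
      then show "joint_tail (?F c) (scale_direction (b /\<^sub>R 2) t) \<in> O[at_top](joint_tail (?F c) t)"
        by (intro mv_dominatedly_varying_bigo F t)
      show "joint_tail (?F c) t \<in> O[at_top](joint_tail ?S t)"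
        using F_le_S by (intro landau_o.big_mono) (simp add: joint_tail_nonneg)
    qed
    then have "(\<lambda>x. \<Sum>c\<in>UNIV. joint_tail (?F c) (scale_direction (b /\<^sub>R 2) t) x)
        \<in> O[at_top](joint_tail ?S t)"
      by (intro big_sum_in_bigo)
    moreover have "joint_tail ?S (scale_direction b t)
        \<in> O[at_top](\<lambda>x. \<Sum>c\<in>UNIV. joint_tail (?F c) (scale_direction (b /\<^sub>R 2) t) x)"
      using joint_tail_sum_le[OF assms(1-3) t] b
      by (intro landau_o.big_mono) (simp add: joint_tail_nonneg sum_nonneg)
    ultimately show ?thesis
      using landau_o.big_trans by blast
  qed

  have dv: "dominatedly_varying (marginal ?S i)" for i
    using S pos bigo by (rule dominatedly_varying_marginal)

  \<comment> \<open>\<open>S_half\<close> returns from \<open>x / 2\<close> to \<open>x\<close> in the target coordinate \<open>j\<close>; each summand is taken from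
    coordinate \<open>i\<close> to \<open>j\<close> by its own weak kernel.\<close>
  have comparable: "tail (marginal ?S i) \<in> O[at_top](tail (marginal ?S j))" for i j
  proof -
    have half: "filterlim (\<lambda>x::real. x / 2) at_top at_top"
      using filterlim_tendsto_pos_mult_at_top[OF tendsto_const, of "1 / 2 :: real"] filterlim_ident
      by (fastforce simp: field_simps)
    have S_half: "(\<lambda>x. tail (marginal ?S j) (x / 2)) \<in> O[at_top](tail (marginal ?S j))"
    proof (subst Limsup_quotient_finite_iff_bigo[symmetric])
      show "0 < tail (marginal ?S j) x" if "0 \<le> x" for x
        using dv[of j] that by (simp add: dominatedly_varying_def)
      show "Limsup at_top (\<lambda>x. ereal (tail (marginal ?S j) (x / 2) / tail (marginal ?S j) x)) < \<infinity>"
        using dv[of j] by (auto simp: dominatedly_varying_def dest!: spec[of _ "1/2"])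
    qed (simp add: tail_marginal[OF S])
    have summand: "(\<lambda>x. tail (marginal (distr M borel Y) i) (x / 2)) \<in> O[at_top](tail (marginal ?S j))"
      if Y: "Y \<in> borel_measurable M" "mv_dominatedly_varying (distr M borel Y)"
        and le: "\<And>x. tail (marginal (distr M borel Y) j) x \<le> tail (marginal ?S j) x" for Y
    proof (rule landau_o.big_trans[OF _ S_half])
      have "tail (marginal (distr M borel Y) j) \<in> O[at_top](tail (marginal ?S j))"
        using le Y(1) by (intro landau_o.big_mono) (simp add: tail_marginal_distr assms(1))
      then have "tail (marginal (distr M borel Y) i) \<in> O[at_top](tail (marginal ?S j))"
        using marginal_tails_comparable[OF Y(2)] landau_o.big_trans by blast
      then show "(\<lambda>x. tail (marginal (distr M borel Y) i) (x / 2))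
          \<in> O[at_top](\<lambda>x. tail (marginal ?S j) (x / 2))"
        using half by (rule landau_o.big.compose)
    qed
    have "tail (marginal ?S i) \<in> O[at_top](\<lambda>x.
        tail (marginal (distr M borel X1) i) (x / 2) + tail (marginal (distr M borel X2) i) (x / 2))"
      using tail_marginal_sum_le[OF assms(1-3)]
      by (intro landau_o.big_mono) (simp add: tail_marginal_distr assms(1))
    also have "(\<lambda>x.
        tail (marginal (distr M borel X1) i) (x / 2) + tail (marginal (distr M borel X2) i) (x / 2))
        \<in> O[at_top](tail (marginal ?S j))"
      using tail_marginal_summand_le[OF assms(1-5)] assms(2,3,6,7)
      by (intro sum_in_bigo summand)
    finally show ?thesis .
  qed

  have "\<exists>G. dominatedly_varying G \<and> (\<forall>i. tail (marginal ?S i) \<in> \<Theta>[at_top](tail G))"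
    using dv[of undefined] comparable by (auto intro!: exI bigthetaI simp: bigomega_iff_bigo)
  moreover have "Limsup at_top
      (\<lambda>x. ereal (joint_tail ?S (scale_direction b t) x / joint_tail ?S t x)) < \<infinity>"
    if "t \<in> tail_directions" "\<forall>i. 0 < b $ i \<and> b $ i < 1" for t b
  proof (subst Limsup_quotient_finite_iff_bigo)
    show "joint_tail ?S (scale_direction b t) \<in> O(joint_tail ?S t)"
      using that by (rule bigo)
  qed (simp_all add: joint_tail_nonneg pos that)
  ultimately show ?thesis
    using S pos by (simp add: mv_dominatedly_varying_def)
qed

end
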